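(* There are uncountably many infinite words over a $4$-letter alphabet that contain no squares in arithmetic progressions of odd difference.
   Context: Infinite words $\mathbf{w} = w_0w_1w_2\cdots$ are indexed from $0$. An arithmetic subsequence of difference $j$ of $\mathbf{w}$ is a word $w_iw_{i+j}w_{i+2j}\cdots$ with $i \geq 0$, $j \geq 1$. A square is a word $xx$ with $x$ non-empty. A word contains no squares in arithmetic progressions of odd difference if, for every odd $j\ge 1$, no arithmetic subsequence of difference $j$ contains a square as a contiguous block. *)

theory Defs
  imports "HOL-Library.Countable_Set" "HOL-Library.Omega_Words_Fun"
begin

definition arith_subseq :: "nat \<Rightarrow> nat \<Rightarrow> 'a word \<Rightarrow> 'a word" where
  "arith_subseq i j w = (\<lambda>n. w (i + n * j))"

definition is_square :: "'a list \<Rightarrow> bool" where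
  "is_square u \<longleftrightarrow> (\<exists>x. x \<noteq> [] \<and> u = x @ x)"

(* w [m \<rightarrow> n] is the contiguous block w_m ... w_(n-1). *)
definition contains_square :: "'a word \<Rightarrow> bool" where
  "contains_square w \<longleftrightarrow> (\<exists>m n. is_square (w [m \<rightarrow> n]))"

(* An odd j automatically satisfies j \<ge> 1. *)
definition no_squares_in_odd_APs :: "'a word \<Rightarrow> bool" where
  "no_squares_in_odd_APs w \<longleftrightarrow>
     (\<forall>i j. odd j \<longrightarrow> \<not> contains_square (arith_subseq i j w))"

end

theory Submission
  imports Defs "HOL-Number_Theory.Cong"
begin

text \<open>
  The letters are identified with pairs of booleans. Letter number \<open>m\<close> of the word is the pair of
  the parity of \<open>m\<close> and the letter of a paperfolding sequence at \<open>m\<close>: for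
  \<open>m = 2 ^ k * q\<close> with \<open>q\<close> odd, the latter says whether \<open>q\<close> is \<open>3\<close> modulo \<open>4\<close>, negated when \<open>k\<close>
  lies in a parameter set \<open>S\<close>. Read along a progression of odd difference \<open>j\<close>, a square of period
  \<open>l\<close> would make positions \<open>p\<close> and \<open>p + l * j\<close> carry equal letters for \<open>l\<close> consecutive
  terms \<open>p\<close> of the progression. If \<open>l\<close> is odd, the two parities disagree. If \<open>l = 2 ^ Suc k * q\<close> with
  \<open>q\<close> odd, then, since \<open>j\<close> is invertible modulo \<open>2 ^ Suc k\<close>, some such \<open>p\<close> is \<open>2 ^ k\<close> times an odd
  number (\<open>odd_AP_meets_residue\<close>); adding \<open>l * j\<close> changes that odd number by twice an
  odd number and so flips the paperfolding letter (\<open>paperfold_flip\<close>).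

  The letter at \<open>2 ^ k\<close> reveals whether \<open>k \<in> S\<close>, so different parameters give different words, and
  there are uncountably many sets of natural numbers.
\<close>

lemma contains_square_iff:
  "contains_square w \<longleftrightarrow> (\<exists>m l. l > 0 \<and> (\<forall>t<l. w (m + t) = w (m + t + l)))"
proof
  assume "contains_square w"
  then obtain m n x where x: "x \<noteq> []" "w [m \<rightarrow> n] = x @ x"
    unfolding contains_square_def is_square_def by blast
  have len: "n - m = length x + length x"
    using arg_cong[OF x(2), of length] by simp
  have "w (m + t) = w (m + t + length x)" if t: "t < length x" for t
  proof -
    have "w (m + t) = (x @ x) ! t" "w (m + t + length x) = (x @ x) ! (t + length x)"
      unfolding x(2)[symmetric] using len t by (simp_all add: subsequence_def add.assoc)
    then show ?thesis using t by (simp add: nth_append)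
  qed
  then show "\<exists>m l. l > 0 \<and> (\<forall>t<l. w (m + t) = w (m + t + l))"
    using x(1) by (intro exI[of _ m] exI[of _ "length x"]) simp
next
  assume "\<exists>m l. l > 0 \<and> (\<forall>t<l. w (m + t) = w (m + t + l))"
  then obtain m l where l: "l > 0" "\<And>t. t < l \<Longrightarrow> w (m + t) = w (m + t + l)" by blast
  have "w (m + n) = w (m + l + n)" if "n < l" for n
    using l(2)[OF that] by (simp add: ac_simps)
  then have "(w [m \<rightarrow> m + l]) = (w [m + l \<rightarrow> m + l + l])"
    by (intro nth_equalityI) simp_all
  moreover have "(w [m \<rightarrow> m + l + l]) = (w [m \<rightarrow> m + l]) @ (w [m + l \<rightarrow> m + l + l])"
    using upt_add_eq_append[of m "m + l" l] by (simp add: subsequence_def)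
  ultimately have "(w [m \<rightarrow> m + l + l]) = (w [m \<rightarrow> m + l]) @ (w [m \<rightarrow> m + l])"
    by simp
  moreover have "(w [m \<rightarrow> m + l]) \<noteq> []" using l(1) by simp
  ultimately show "contains_square w"
    unfolding contains_square_def is_square_def by blast
qed

text \<open>For an odd number \<open>q\<close>, the parity of \<open>q div 2\<close> tells the residues \<open>1\<close> and \<open>3\<close> modulo \<open>4\<close> apart.
  The set \<open>S\<close> plays the part of the unfolding instructions of a paperfolding sequence.\<close>

definition paperfold :: "nat set \<Rightarrow> nat \<Rightarrow> bool" where
  "paperfold S m \<longleftrightarrow>
     (multiplicity 2 m \<in> S) \<noteq> odd (m div 2 ^ multiplicity 2 m div 2)"

lemma paperfold_power_mult:
  assumes "odd q"
  shows "paperfold S (2 ^ k * q) \<longleftrightarrow> (k \<in> S) \<noteq> odd (q div 2)"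
proof -
  have "multiplicity 2 (2 ^ k * q) = k"
    by (rule multiplicity_eqI) (use assms in auto)
  then show ?thesis by (simp add: paperfold_def)
qed

text \<open>The two positions share the exact power \<open>2 ^ k\<close>, so \<open>S\<close> acts on both in the same way,
  while their odd parts differ by \<open>2\<close> modulo \<open>4\<close>.\<close>

lemma paperfold_flip:
  assumes "odd q" "odd r"
  shows "paperfold S (2 ^ k * q + 2 ^ Suc k * r) \<noteq> paperfold S (2 ^ k * q)"
proof -
  have "2 ^ k * q + 2 ^ Suc k * r = 2 ^ k * (q + 2 * r)"
    by (simp add: algebra_simps)
  moreover have "odd (q + 2 * r)" "(q + 2 * r) div 2 = q div 2 + r"
    using assms(1) by simp_all
  ultimately show ?thesis
    using assms by (auto simp: paperfold_power_mult)
qed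

lemma odd_AP_meets_residue:
  fixes i j k r :: nat
  assumes "odd j"
  obtains t where "t < 2 ^ k" "[i + t * j = r] (mod 2 ^ k)"
proof -
  define M :: nat where "M = 2 ^ k"
  have M: "M > 0" by (simp add: M_def)
  have "coprime j M" using assms by (simp add: M_def)
  then obtain x where x: "[j * x = 1] (mod M)"
    using cong_solve_coprime_nat by auto
  \<comment> \<open>On natural numbers, \<open>i * (M - 1)\<close> stands for \<open>- i\<close> modulo \<open>M\<close>.\<close>
  define s where "s = r + i * (M - 1)"
  show thesis
  proof
    show "(x * s) mod M < 2 ^ k" using M by (simp flip: M_def)
    have "[i + (x * s) mod M * j = i + (j * x) * s] (mod M)"
      by (intro cong_add cong_refl) (simp add: cong_def mod_simps ac_simps)
    also have "[i + (j * x) * s = i + 1 * s] (mod M)"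
      using x by (intro cong_add cong_mult cong_refl)
    also have "i + 1 * s = r + i * M"
      using M by (cases M) (simp_all add: s_def)
    also have "[r + i * M = r] (mod M)" by (simp add: cong_def)
    finally show "[i + (x * s) mod M * j = r] (mod 2 ^ k)" by (simp add: M_def)
  qed
qed

definition fold_word :: "nat set \<Rightarrow> (bool \<times> bool) word" where
  "fold_word S m = (odd m, paperfold S m)"

lemma no_squares_in_odd_APs_fold_word: "no_squares_in_odd_APs (fold_word S)"
  unfolding no_squares_in_odd_APs_def
proof (intro allI impI notI)
  fix i j :: nat
  assume j: "odd j" and "contains_square (arith_subseq i j (fold_word S))"
  then obtain m l where l: "l > 0"
    and sq: "\<And>t. t < l \<Longrightarrow> fold_word S (i + (m + t) * j) = fold_word S (i + (m + t + l) * j)"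
    by (auto simp: arith_subseq_def contains_square_iff)
  have "even l" using sq[OF l] j by (auto simp: fold_word_def)
  obtain e q where eq: "l = 2 ^ e * q" "odd q"
    by (rule multiplicity_decompose'[of l 2]) (use l in auto)
  with \<open>even l\<close> obtain k where k: "e = Suc k" by (cases e) auto
  \<comment> \<open>The residue \<open>2 ^ k\<close> modulo \<open>2 ^ Suc k\<close> characterises the odd multiples of \<open>2 ^ k\<close>.\<close>
  obtain t where t: "t < 2 ^ Suc k" "[(i + m * j) + t * j = 2 ^ k] (mod 2 ^ Suc k)"
    using odd_AP_meets_residue[OF j] by blast
  define p where "p = i + (m + t) * j"
  have p: "p mod 2 ^ Suc k = 2 ^ k"
    using t(2) by (simp add: p_def cong_def algebra_simps)
  then have "p = 2 ^ k * (1 + 2 * (p div 2 ^ Suc k))"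
    using div_mult_mod_eq[of p "2 ^ Suc k"] by (simp add: algebra_simps)
  then obtain o' where o': "p = 2 ^ k * o'" "odd o'" by fastforce
  have "q > 0" using eq(2) by (cases q) auto
  then have "2 ^ Suc k \<le> l" by (simp add: eq(1) k)
  with t(1) have "t < l" by simp
  then have "fold_word S p = fold_word S (i + (m + t + l) * j)"
    using sq[of t] by (simp only: p_def)
  also have "i + (m + t + l) * j = p + 2 ^ Suc k * (q * j)"
    by (simp add: p_def eq(1) k algebra_simps)
  finally have "paperfold S (2 ^ k * o') = paperfold S (2 ^ k * o' + 2 ^ Suc k * (q * j))"
    by (simp only: fold_word_def o'(1) prod.inject)
  then show False
    using paperfold_flip[of o' "q * j"] o'(2) eq(2) j by auto
qed

lemma inj_fold_word: "inj fold_word"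
proof (rule injI)
  fix S T assume "fold_word S = fold_word T"
  then have "paperfold S (2 ^ k) = paperfold T (2 ^ k)" for k
    by (metis fold_word_def prod.inject)
  then show "S = T"
    using paperfold_power_mult[of 1] by auto
qed

lemma no_squares_in_odd_APs_comp_iff:
  assumes "inj c"
  shows "no_squares_in_odd_APs (c \<circ> w) \<longleftrightarrow> no_squares_in_odd_APs w"
  using assms
  by (simp add: no_squares_in_odd_APs_def contains_square_iff arith_subseq_def inj_eq)

lemma uncountable_UNIV_nat_set: "uncountable (UNIV :: nat set set)"
proof
  assume "countable (UNIV :: nat set set)"
  then obtain f :: "nat \<Rightarrow> nat set" where "range f = UNIV"
    using uncountable_def[of "UNIV :: nat set set"] by auto
  then show False using Cantors_theorem[of "UNIV :: nat set"] by simp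
qed

theorem mainTheorem2:
  fixes A :: "'a set"
  assumes "card A = 4"
  shows "uncountable {w :: 'a word. range w \<subseteq> A \<and> no_squares_in_odd_APs w}"
proof -
  have "finite A" using assms by (simp add: card_ge_0_finite)
  then obtain c :: "bool \<times> bool \<Rightarrow> 'a" where "bij_betw c UNIV A"
    using finite_same_card_bij[of "UNIV :: (bool \<times> bool) set" A] assms
      card_cartesian_product[of "UNIV :: bool set" "UNIV :: bool set"]
    by auto
  then have c: "inj c" "range c = A" by (simp_all add: bij_betw_def)
  let ?W = "{w :: 'a word. range w \<subseteq> A \<and> no_squares_in_odd_APs w}"
  have "inj (\<lambda>S. c \<circ> fold_word S)"
    using inj_compose[OF fun.inj_map[OF c(1)] inj_fold_word] by (simp add: comp_def)
  then have "uncountable (range (\<lambda>S. c \<circ> fold_word S))"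
    using uncountable_UNIV_nat_set by (simp add: countable_image_inj_eq)
  moreover have "range (\<lambda>S. c \<circ> fold_word S) \<subseteq> ?W"
    using c by (auto simp: no_squares_in_odd_APs_comp_iff no_squares_in_odd_APs_fold_word)
  ultimately show ?thesis
    using countable_subset by blast
qed

end
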